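(* Let $A$ be a $3\times 3$ real matrix. Then $A$ is normal if and only if the origin belongs to $\operatorname{soma}(\mathcal{T}_A)$, in $Z=0$.
   Context: $\mathbb{T}=\mathbb{R}\cup\{-\infty\}$ with $a\oplus b=\max\{a,b\}$, $a\odot b=a+b$; matrices are multiplied using $\oplus,\odot$. $\mathbb{T}\mathbb{P}^2$ is the quotient of $\mathbb{T}^3\setminus\{(-\infty,-\infty,-\infty)\}$ by $(p_1,p_2,p_3)\sim(\lambda+p_1,\lambda+p_2,\lambda+p_3)$, $\lambda\in\mathbb{R}$; points are written as columns $[p_1,p_2,p_3]$. "In $Z=0$" means that $[x,y,z]$ with $z\neq-\infty$ is identified with $(x-z,y-z)$; the origin is the point $[0,0,0]$. A real matrix $A=(a_{ij})$ is normal if $a_{ii}=0$ for all $i$ and $a_{ij}\le0$ for all $i,j$. For a matrix $M$, $f_M:p\mapsto M\odot p$ on $\mathbb{T}\mathbb{P}^2$. $\mathcal{T}_M$ is the tropical span of the columns of $M$ in $\mathbb{T}\mathbb{P}^2$, i.e. all points represented by $\max\{\lambda_1+\operatorname{col}(M,1),\lambda_2+\operatorname{col}(M,2),\lambda_3+\operatorname{col}(M,3)\}$ with $\lambda_j\in\mathbb{T}$ not all $-\infty$. A permutation matrix is a matrix obtained from a diagonal matrix (real diagonal, $-\infty$ elsewhere) by permuting some rows or some columns; $P^{\odot-1}$ is its tropical inverse. For $d,d_1,d_2,d_3,h_1,h_2,h_3,g\ge0$ such that (subscripts mod 3) $h_{j+1}>0$ implies $d_j=0$, and $g>0$ implies $d=d_1=h_3=0$,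 set $$F(d,d_1,d_2,d_3,h_1,h_2,h_3,g)=\left[\begin{array}{ccc} 0&-d-d_2&-2d-d_3-h_3\\ -2d-d_1-h_1&0&-d-d_3-g\\ -d-d_1&-2d-d_2-h_2&0 \end{array}\right],$$ $$L(d,d_1,d_2,d_3)=F(d,d_1,d_2,d_3,0,0,0,0).$$ Every real $3\times3$ matrix $A$ has a lower canonical normalization $N=F(d,d_1,d_2,d_3,h_1,h_2,h_3,g)=P\odot A\odot Q$ with $P,Q$ permutation matrices. One defines $\operatorname{soma}(\mathcal{T}_N)=\mathcal{T}_{L(d,d_1,d_2,d_3)}$ and $\operatorname{soma}(\mathcal{T}_A)=f_{P^{\odot-1}}(\operatorname{soma}(\mathcal{T}_N))$.
   Formalization: "A is normal" is read as "A⊙Q is normal for some permutation matrix Q", since the soma ignores column order and scaling (a constant matrix 5 is a counterexample); lower canonical normalizations also require h1=0 when g>0, as otherwise the soma is not unique. *)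

theory Defs
  imports "HOL-Analysis.Analysis"
begin

section \<open>The max-plus semiring\<close>

datatype trop = MInf | Trop real

text \<open>
  With the tropical operations as the semiring operations, \<open>0\<close> is \<open>-\<infinity>\<close> and \<open>1\<close> is the
  real number zero, so that \<open>**\<close>, \<open>*v\<close>, \<open>*s\<close>, \<open>mat 1\<close> and \<open>matrix_inv\<close> on matrices with
  entries of type \<open>trop\<close> are the tropical notions.
\<close>

instantiation trop :: comm_semiring_1
begin

definition zero_trop :: trop where "zero_trop = MInf"

definition one_trop :: trop where "one_trop = Trop 0"

fun plus_trop :: "trop \<Rightarrow> trop \<Rightarrow> trop" where
  "plus_trop MInf y = y"
| "plus_trop x MInf = x"
| "plus_trop (Trop a) (Trop b) = Trop (max a b)"

fun times_trop :: "trop \<Rightarrow> trop \<Rightarrow> trop" where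
  "times_trop MInf y = MInf"
| "times_trop x MInf = MInf"
| "times_trop (Trop a) (Trop b) = Trop (a + b)"

instance
proof
  fix a b c :: trop
  show "a + b + c = a + (b + c)" by (cases a; cases b; cases c) (auto simp: max_def)
  show "a + b = b + a" by (cases a; cases b) (auto simp: max_def)
  show "0 + a = a" by (simp add: zero_trop_def)
  show "a * b * c = a * (b * c)" by (cases a; cases b; cases c) auto
  show "a * b = b * a" by (cases a; cases b) auto
  show "1 * a = a" unfolding one_trop_def by (cases a) auto
  show "(a + b) * c = a * c + b * c" by (cases a; cases b; cases c) (auto simp: max_def)
  show "0 * a = 0" by (simp add: zero_trop_def)
  show "a * 0 = 0" by (cases a) (auto simp: zero_trop_def)
  show "(0::trop) \<noteq> 1" by (simp add: zero_trop_def one_trop_def)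
qed

end

definition trop_mat :: "real^'n^'m \<Rightarrow> trop^'n^'m" where
  "trop_mat A = (\<chi> i j. Trop (A $ i $ j))"

section \<open>The tropical projective plane\<close>

definition proj_rel :: "trop^3 \<Rightarrow> trop^3 \<Rightarrow> bool" where
  "proj_rel p q \<longleftrightarrow> p \<noteq> 0 \<and> q \<noteq> 0 \<and> (\<exists>c::real. q = Trop c *s p)"

lemma smult_trop_inverse: "Trop (- l) *s (Trop l *s (p::trop^3)) = p"
proof -
  have "Trop (- l) * (Trop l * x) = x" for x by (cases x) auto
  then show ?thesis unfolding vec_eq_iff vector_smult_component by blast
qed

lemma smult_trop_smult: "Trop m *s (Trop l *s (p::trop^3)) = Trop (m + l) *s p"
  by (simp add: vec_eq_iff flip: mult.assoc)

quotient_type tp2 = "trop^3" / partial: proj_rel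
proof (rule part_equivpI)
  have "Trop 0 *s (1::trop^3) = 1"
    by (simp add: vec_eq_iff flip: one_trop_def)
  moreover have "(1::trop^3) \<noteq> 0" by (simp add: vec_eq_iff)
  ultimately show "\<exists>p. proj_rel p p"
    by (intro exI[of _ 1]) (force simp: proj_rel_def)
  show "symp proj_rel"
    by (rule sympI) (metis proj_rel_def smult_trop_inverse)
  show "transp proj_rel"
    by (rule transpI) (metis proj_rel_def smult_trop_smult)
qed

text \<open>\<open>tpt p\<close> is the class of \<open>p\<close>; it is meaningful only for \<open>p \<noteq> 0\<close>, that is,
  \<open>p \<noteq> (-\<infinity>, -\<infinity>, -\<infinity>)\<close>.\<close>

definition tpt :: "trop^3 \<Rightarrow> tp2" where
  "tpt p = abs_tp2 p"

text \<open>The point whose coordinates in the chart \<open>Z = 0\<close>, where \<open>[x, y, z]\<close> with finite \<open>z\<close>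
  is \<open>(x - z, y - z)\<close>, are \<open>(0, 0)\<close>.\<close>

definition origin :: tp2 where
  "origin = tpt (vector [Trop 0, Trop 0, Trop 0])"

definition trop_map :: "trop^3^3 \<Rightarrow> tp2 \<Rightarrow> tp2" where
  "trop_map M x = tpt (M *v rep_tp2 x)"

lemma proj_rel_refl:
  assumes "p \<noteq> 0"
  shows "proj_rel p p"
proof -
  have "Trop 0 *s p = p" by (simp add: vec_eq_iff flip: one_trop_def)
  with assms show ?thesis unfolding proj_rel_def by metis
qed

lemma tpt_eq_iff:
  assumes "p \<noteq> 0" "q \<noteq> 0"
  shows "tpt p = tpt q \<longleftrightarrow> (\<exists>c::real. q = Trop c *s p)"
proof -
  have "tpt p = tpt q \<longleftrightarrow> proj_rel p q"
    unfolding tpt_def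
    using Quotient3_rel[OF Quotient3_tp2, of p q] assms proj_rel_refl by blast
  with assms show ?thesis by (simp add: proj_rel_def)
qed

lemma trop_map_tpt:
  assumes "p \<noteq> 0" "M *v p \<noteq> 0"
  shows "trop_map M (tpt p) = tpt (M *v p)"
proof -
  let ?q = "rep_tp2 (tpt p)"
  have "proj_rel p ?q"
    unfolding tpt_def by (rule rep_abs_rsp[OF Quotient3_tp2 proj_rel_refl[OF assms(1)]])
  then obtain l where l: "?q = Trop l *s p" by (auto simp: proj_rel_def)
  have *: "M *v ?q = Trop l *s (M *v p)"
    by (simp add: l matrix_vector_mult_def vec_eq_iff sum_distrib_left mult.left_commute)
  have "M *v ?q \<noteq> 0"
  proof
    assume "M *v ?q = 0"
    then have "Trop (- l) *s (Trop l *s (M *v p)) = 0"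
      unfolding * by simp
    with assms(2) show False by (simp only: smult_trop_inverse)
  qed
  then have "tpt (M *v p) = tpt (M *v ?q)"
    using tpt_eq_iff[OF assms(2)] * by blast
  then show ?thesis by (simp add: trop_map_def)
qed

section \<open>Normal matrices, permutation matrices, tropical spans\<close>

definition normal :: "real^'n^'n \<Rightarrow> bool" where
  "normal A \<longleftrightarrow> (\<forall>i. A $ i $ i = 0) \<and> (\<forall>i j. A $ i $ j \<le> 0)"

definition trop_diag :: "real^'n \<Rightarrow> trop^'n^'n" where
  "trop_diag c = (\<chi> i j. if i = j then Trop (c $ i) else MInf)"

definition permutation_matrix :: "trop^'n^'n \<Rightarrow> bool" where
  "permutation_matrix P \<longleftrightarrow>
     (\<exists>(c::real^'n) (\<pi>::'n \<Rightarrow> 'n) (\<rho>::'n \<Rightarrow> 'n). bij \<pi> \<and> bij \<rho> \<and> P = (\<chi> i j. trop_diag c $ \<pi> i $ \<rho> j))"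

text \<open>The matrix is real, so any combination with a coefficient different from \<open>-\<infinity>\<close>
  is a nonzero vector.\<close>

definition trop_span :: "real^3^3 \<Rightarrow> tp2 set" where
  "trop_span M =
     {tpt (\<Sum>j\<in>UNIV. l $ j *s column j (trop_mat M)) | l :: trop^3. l \<noteq> 0}"

section \<open>Lower canonical normalizations and the soma\<close>

definition F_mat :: "real \<Rightarrow> real \<Rightarrow> real \<Rightarrow> real \<Rightarrow> real \<Rightarrow> real \<Rightarrow> real \<Rightarrow> real \<Rightarrow> real^3^3" where
  "F_mat d d1 d2 d3 h1 h2 h3 g = vector [
     vector [0, - d - d2, - 2 * d - d3 - h3],
     vector [- 2 * d - d1 - h1, 0, - d - d3 - g],
     vector [- d - d1, - 2 * d - d2 - h2, 0]]"

definition L_mat :: "real \<Rightarrow> real \<Rightarrow> real \<Rightarrow> real \<Rightarrow> real^3^3" where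
  "L_mat d d1 d2 d3 = F_mat d d1 d2 d3 0 0 0 0"

definition F_params :: "real \<Rightarrow> real \<Rightarrow> real \<Rightarrow> real \<Rightarrow> real \<Rightarrow> real \<Rightarrow> real \<Rightarrow> real \<Rightarrow> bool" where
  "F_params d d1 d2 d3 h1 h2 h3 g \<longleftrightarrow>
     d \<ge> 0 \<and> d1 \<ge> 0 \<and> d2 \<ge> 0 \<and> d3 \<ge> 0 \<and> h1 \<ge> 0 \<and> h2 \<ge> 0 \<and> h3 \<ge> 0 \<and> g \<ge> 0 \<and>
     (h2 > 0 \<longrightarrow> d1 = 0) \<and> (h3 > 0 \<longrightarrow> d2 = 0) \<and> (h1 > 0 \<longrightarrow> d3 = 0) \<and>
     (g > 0 \<longrightarrow> d = 0 \<and> d1 = 0 \<and> h3 = 0)"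

text \<open>
  The last conjunct goes beyond \<open>F_params\<close>, which alone does not make the soma unique: the
  matrix \<open>F_mat 0 0 d2 0 h1 h2 0 g\<close> with \<open>0 < h1 \<le> g\<close> satisfies \<open>F_params\<close>, and adding
  \<open>h1\<close> to its second row and \<open>-h1\<close> to its second column turns it into
  \<open>F_mat 0 0 (d2 + h1) 0 0 h2 0 (g - h1)\<close>, which satisfies \<open>F_params\<close> as well. In the
  coordinates of the former, the somas are the segments from \<open>(0, 0)\<close> and from \<open>(0, -h1)\<close>,
  respectively, to \<open>(0, d2)\<close>. The case \<open>0 < g < h1\<close> is analogous, with \<open>g\<close> in place of
  \<open>h1\<close>. The conjunct discards the normalization with the smaller soma; for the remaining
  ones, \<open>L_mat\<close> is the Kleene star of \<open>F_mat\<close>.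
\<close>

definition lower_canonical_normalization ::
  "real^3^3 \<Rightarrow> trop^3^3 \<Rightarrow> trop^3^3 \<Rightarrow>
   real \<Rightarrow> real \<Rightarrow> real \<Rightarrow> real \<Rightarrow> real \<Rightarrow> real \<Rightarrow> real \<Rightarrow> real \<Rightarrow> bool" where
  "lower_canonical_normalization A P Q d d1 d2 d3 h1 h2 h3 g \<longleftrightarrow>
     permutation_matrix P \<and> permutation_matrix Q \<and>
     F_params d d1 d2 d3 h1 h2 h3 g \<and>
     trop_mat (F_mat d d1 d2 d3 h1 h2 h3 g) = P ** trop_mat A ** Q \<and>
     (g > 0 \<longrightarrow> h1 = 0)"

definition is_soma :: "real^3^3 \<Rightarrow> tp2 set \<Rightarrow> bool" where
  "is_soma A S \<longleftrightarrow> (\<exists>P Q d d1 d2 d3 h1 h2 h3 g.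
     lower_canonical_normalization A P Q d d1 d2 d3 h1 h2 h3 g \<and>
     S = trop_map (matrix_inv P) ` trop_span (L_mat d d1 d2 d3))"

definition soma :: "real^3^3 \<Rightarrow> tp2 set" where
  "soma A = (THE S. is_soma A S)"

section \<open>Rescaling and reordering columns\<close>

text \<open>
  As points of the projective plane, and up to their order, the columns of \<open>A\<close> and of
  \<open>A ** Q\<close> are the same for a permutation matrix \<open>Q\<close>.
\<close>

definition column_equivalent :: "real^3^3 \<Rightarrow> real^3^3 \<Rightarrow> bool" where
  "column_equivalent A B \<longleftrightarrow>
     (\<exists>Q. permutation_matrix Q \<and> trop_mat B = trop_mat A ** Q)"

lemma permutation_matrix_alt:
  "permutation_matrix (P :: trop^'n^'n) \<longleftrightarrow>
     (\<exists>c \<sigma>. bij \<sigma> \<and> P = (\<chi> i j. if j = \<sigma> i then Trop (c i) else 0))"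
proof
  assume "permutation_matrix P"
  then obtain c :: "real^'n" and \<pi> \<rho> :: "'n \<Rightarrow> 'n"
    where b: "bij \<pi>" "bij \<rho>" and P: "P = (\<chi> i j. trop_diag c $ \<pi> i $ \<rho> j)"
    by (auto simp: permutation_matrix_def)
  have "\<pi> i = \<rho> j \<longleftrightarrow> j = (inv \<rho> \<circ> \<pi>) i" for i j
    using b(2) by (metis bij_inv_eq_iff comp_apply)
  then have "P = (\<chi> i j. if j = (inv \<rho> \<circ> \<pi>) i then Trop (c $ \<pi> i) else 0)"
    by (simp add: P trop_diag_def zero_trop_def vec_eq_iff)
  moreover have "bij (inv \<rho> \<circ> \<pi>)" using b by (simp add: bij_comp bij_imp_bij_inv)
  ultimately show "\<exists>c \<sigma>. bij \<sigma> \<and> P = (\<chi> i j. if j = \<sigma> i then Trop (c i) else 0)"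
    by (intro exI[of _ "\<lambda>i. c $ \<pi> i"] exI[of _ "inv \<rho> \<circ> \<pi>"]) auto
next
  assume "\<exists>c \<sigma>. bij \<sigma> \<and> P = (\<chi> i j. if j = \<sigma> i then Trop (c i) else 0)"
  then obtain c \<sigma> where b: "bij \<sigma>" and P: "P = (\<chi> i j. if j = \<sigma> i then Trop (c i) else 0)"
    by auto
  have "\<sigma> i = j \<longleftrightarrow> j = \<sigma> i" for i j by auto
  moreover have "inv \<sigma> (\<sigma> i) = i" for i using b by (simp add: bij_is_inj)
  ultimately have "P = (\<chi> i j. trop_diag (\<chi> i. c (inv \<sigma> i)) $ \<sigma> i $ id j)"
    by (simp add: P trop_diag_def zero_trop_def vec_eq_iff)
  with b show "permutation_matrix P"
    unfolding permutation_matrix_def using bij_id by blast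
qed

lemma monomial_matrix_mult:
  "(\<chi> i j. if j = \<sigma> i then Trop (c i) else (0::trop)) **
   (\<chi> i j. if j = \<tau> i then Trop (e i) else 0) =
   (\<chi> i j. if j = \<tau> (\<sigma> i) then Trop (c i + e (\<sigma> i)) else 0)"
proof -
  have "(\<Sum>k\<in>UNIV. (if k = \<sigma> i then Trop (c i) else 0) *
          (if j = \<tau> k then Trop (e k) else 0)) =
        (if j = \<tau> (\<sigma> i) then Trop (c i + e (\<sigma> i)) else 0)" (is "?l = ?r") for i j
  proof -
    have "?l = (\<Sum>k\<in>UNIV. if k = \<sigma> i then Trop (c i) *
          (if j = \<tau> k then Trop (e k) else 0) else 0)"
      by (intro sum.cong) auto
    then show ?thesis by simp
  qed
  then show ?thesis by (simp add: matrix_matrix_mult_def vec_eq_iff)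
qed

lemma permutation_matrix_mult:
  assumes "permutation_matrix P" "permutation_matrix Q"
  shows "permutation_matrix (P ** Q)"
proof -
  obtain c \<sigma> where P: "bij \<sigma>" "P = (\<chi> i j. if j = \<sigma> i then Trop (c i) else 0)"
    using assms(1) unfolding permutation_matrix_alt by (elim exE conjE)
  obtain e \<tau> where Q: "bij \<tau>" "Q = (\<chi> i j. if j = \<tau> i then Trop (e i) else 0)"
    using assms(2) unfolding permutation_matrix_alt by (elim exE conjE)
  show ?thesis
    unfolding permutation_matrix_alt P(2) Q(2) monomial_matrix_mult
    using bij_comp[OF P(1) Q(1)]
    by (intro exI[of _ "\<lambda>i. c i + e (\<sigma> i)"] exI[of _ "\<tau> \<circ> \<sigma>"]) simp
qed

lemma permutation_matrix_inverse:
  assumes "permutation_matrix P"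
  obtains R where "permutation_matrix R" "P ** R = mat 1" "R ** P = mat 1"
proof -
  obtain c \<sigma> where P: "bij \<sigma>" "P = (\<chi> i j. if j = \<sigma> i then Trop (c i) else 0)"
    using assms unfolding permutation_matrix_alt by (elim exE conjE)
  define R where "R = (\<chi> i j. if j = inv \<sigma> i then Trop (- c (inv \<sigma> i)) else (0::trop))"
  have "permutation_matrix R"
    unfolding permutation_matrix_alt R_def using bij_imp_bij_inv[OF P(1)]
    by (intro exI[of _ "\<lambda>i. - c (inv \<sigma> i)"] exI[of _ "inv \<sigma>"]) simp
  moreover have "inv \<sigma> (\<sigma> i) = i" "\<sigma> (inv \<sigma> i) = i" for i
    using P(1) by (simp_all add: bij_is_inj bij_is_surj surj_f_inv_f)
  then have "P ** R = mat 1" "R ** P = mat 1"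
    unfolding P(2) R_def monomial_matrix_mult
    by (simp_all add: mat_def vec_eq_iff one_trop_def eq_commute)
  ultimately show thesis by (rule that)
qed

lemma column_equivalent_sym:
  assumes "column_equivalent A B"
  shows "column_equivalent B A"
proof -
  obtain Q where Q: "permutation_matrix Q" "trop_mat B = trop_mat A ** Q"
    using assms by (auto simp: column_equivalent_def)
  obtain R where "permutation_matrix R" "Q ** R = mat 1"
    using permutation_matrix_inverse[OF Q(1)] by metis
  moreover from this(2) have "trop_mat A = trop_mat B ** R"
    by (simp add: Q(2) flip: matrix_mul_assoc)
  ultimately show ?thesis by (auto simp: column_equivalent_def)
qed

text \<open>The soma does not see such a change of columns, whereas normality does. For example,
  exchanging the first two columns of a normal matrix whose off-diagonal entries are all
  negative yields a matrix that is not normal.\<close>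

lemma is_soma_column_equivalent:
  assumes "is_soma B S" and eq: "column_equivalent A B"
  shows "is_soma A S"
proof -
  from assms(1) obtain P Q d d1 d2 d3 h1 h2 h3 g
    where lcn: "lower_canonical_normalization B P Q d d1 d2 d3 h1 h2 h3 g"
      and S: "S = trop_map (matrix_inv P) ` trop_span (L_mat d d1 d2 d3)"
    unfolding is_soma_def by (elim exE conjE)
  obtain R where "permutation_matrix R" "trop_mat B = trop_mat A ** R"
    using eq by (auto simp: column_equivalent_def)
  with lcn have "lower_canonical_normalization A P (R ** Q) d d1 d2 d3 h1 h2 h3 g"
    by (simp add: lower_canonical_normalization_def permutation_matrix_mult matrix_mul_assoc)
  with S show ?thesis unfolding is_soma_def by blast
qed

lemma soma_column_equivalent:
  assumes "column_equivalent A B"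
  shows "soma A = soma B"
proof -
  have "is_soma A S \<longleftrightarrow> is_soma B S" for S
    using assms is_soma_column_equivalent column_equivalent_sym by blast
  then show ?thesis by (simp add: soma_def)
qed

end

theory Submission
  imports Defs
begin

text \<open>
  Regard the entries of \<open>A\<close> as weights of an assignment problem, and let \<open>D\<close> be the set of the row
  potentials \<open>p\<close> of its optimal dual solutions: for suitable column potentials \<open>q\<close> and a
  permutation \<open>\<sigma>\<close>, \<open>A $ i $ k \<le> p $ i + q k\<close> for all \<open>i, k\<close>, with equality at \<open>k = \<sigma> i\<close>. The soma of
  \<open>A\<close> is the image of \<open>D\<close> in the projective plane (\<open>soma_eq_dual_optimal\<close>), and this makes the
  theorem transparent. Adding a constant to all of \<open>p\<close> preserves \<open>D\<close>, so the origin lies in the soma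
  if and only if \<open>0\<close> lies in \<open>D\<close>; this means that each \<open>q k\<close> is the maximum of column \<open>k\<close> and that
  these maxima can be picked in different rows, that is, that rescaling and reordering columns
  makes \<open>A\<close> normal (\<open>column_equivalent_normal_iff\<close>).

  To identify the soma with \<open>D\<close>, let \<open>N = F_mat \<dots>\<close> be a lower canonical normalization. It is
  normal, so complementary slackness turns its optimal dual solutions into the polytrope of all \<open>x\<close>
  with \<open>N $ i $ j \<le> x $ i - x $ j\<close> (\<open>dual_optimal_normal_iff\<close>). Replacing \<open>N\<close> by its Kleene star
  \<open>L_mat\<close> does not change these inequalities (\<open>F_mat_inequalities_iff_L_mat\<close>), and the polytrope of
  a Kleene star is the tropical span of its columns (\<open>trop_span_eq_polytrope\<close>). Permutation
  matrices transport optimal dual solutions (\<open>dual_optimal_equivalent_iff\<close>). Since \<open>D\<close> depends on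
  \<open>A\<close> alone, the soma is independent of the normalization.

  The definite description in \<open>soma\<close> also requires a normalization to exist. A maximal assignment
  moved to the diagonal leaves a matrix without cycles of positive weight. Its Kleene star is a
  translate of some \<open>L_mat\<close> (\<open>parameters_of_closure\<close>), and the amounts by which the matrix falls
  short of its star can be placed at the positions of \<open>h1, h2, h3, g\<close> by relabelling the indices
  (\<open>lower_canonical_normalization_oriented\<close>).
\<close>

section \<open>Optimal dual solutions of an assignment problem\<close>

text \<open>
  A permutation \<open>\<sigma>\<close> is a maximal assignment for the weights \<open>A\<close> if it maximizes the sum of the
  \<open>A $ i $ \<sigma> i\<close>. In the dual linear program one minimizes the sum of all \<open>p $ i\<close> and \<open>q k\<close>; by weak
  duality the pair \<open>p, q\<close> below is optimal, since \<open>\<sigma>\<close> attains its value.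
\<close>

definition dual_optimal :: "real^'n^'n \<Rightarrow> real^'n \<Rightarrow> bool" where
  "dual_optimal A p \<longleftrightarrow> (\<exists>\<sigma> q. bij \<sigma> \<and> (\<forall>i k. A $ i $ k \<le> p $ i + q k) \<and>
     (\<forall>i. A $ i $ \<sigma> i = p $ i + q (\<sigma> i)))"

section \<open>Permutation matrices acting on entries\<close>

definition trop_vec :: "real^'n \<Rightarrow> trop^'n" where
  "trop_vec p = (\<chi> i. Trop (p $ i))"

lemma trop_vec_nonzero: "trop_vec p \<noteq> (0 :: trop^'n)"
  by (simp add: trop_vec_def vec_eq_iff zero_trop_def)

lemma matrix_mult_monomial:
  assumes "bij \<rho>"
  shows "(M ** (\<chi> k j. if j = \<rho> k then Trop (e k) else 0)) $ i $ \<rho> k = M $ i $ k * Trop (e k)"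
proof -
  have "M $ i $ m * (if \<rho> k = \<rho> m then Trop (e m) else 0) =
      (if m = k then M $ i $ m * Trop (e m) else 0)" for m
    using bij_is_inj[OF assms] by (auto simp: inj_eq)
  then show ?thesis by (simp add: matrix_matrix_mult_def)
qed

lemma monomial_mult_matrix:
  "((\<chi> i j. if j = \<pi> i then Trop (c i) else 0) ** M) $ i $ k = Trop (c i) * M $ \<pi> i $ k"
proof -
  have "((\<chi> i j. if j = \<pi> i then Trop (c i) else 0) ** M) $ i $ k =
    (\<Sum>m\<in>UNIV. if m = \<pi> i then Trop (c i) * M $ m $ k else 0)"
    unfolding matrix_matrix_mult_def by (simp del: sum.delta) (intro sum.cong, auto)
  then show ?thesis by simp
qed

lemma monomial_mult_vec:
  "((\<chi> i j. if j = \<pi> i then Trop (c i) else 0) *v v) $ i = Trop (c i) * v $ \<pi> i"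
proof -
  have "((\<chi> i j. if j = \<pi> i then Trop (c i) else 0) *v v) $ i =
    (\<Sum>m\<in>UNIV. if m = \<pi> i then Trop (c i) * v $ m else 0)"
    unfolding matrix_vector_mult_def by (simp del: sum.delta) (intro sum.cong, auto)
  then show ?thesis by simp
qed

text \<open>
  Indexing the columns of the product by \<open>\<rho> k\<close> instead of \<open>j\<close> keeps \<open>inv \<rho>\<close> out of the entrywise
  description.
\<close>
lemma equivalent_iff_entries:
  assumes \<rho>: "bij \<rho>"
  shows "trop_mat N = (\<chi> i j. if j = \<pi> i then Trop (c i) else 0) ** trop_mat A **
      (\<chi> k j. if j = \<rho> k then Trop (e k) else 0) \<longleftrightarrow>
    (\<forall>i k. N $ i $ \<rho> k = c i + A $ \<pi> i $ k + e k)" (is "_ = ?R \<longleftrightarrow> _")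
proof -
  have "trop_mat N = ?R \<longleftrightarrow> (\<forall>i j. trop_mat N $ i $ j = ?R $ i $ j)"
    by (simp add: vec_eq_iff)
  also have "\<dots> \<longleftrightarrow> (\<forall>i k. trop_mat N $ i $ \<rho> k = ?R $ i $ \<rho> k)"
  proof (intro iffI allI)
    fix i j assume "\<forall>i k. trop_mat N $ i $ \<rho> k = ?R $ i $ \<rho> k"
    then have "trop_mat N $ i $ \<rho> (inv \<rho> j) = ?R $ i $ \<rho> (inv \<rho> j)" by (elim allE)
    then show "trop_mat N $ i $ j = ?R $ i $ j" using \<rho> by (simp only: bij_is_surj surj_f_inv_f)
  qed (elim allE)
  also have "\<dots> \<longleftrightarrow> (\<forall>i k. N $ i $ \<rho> k = c i + A $ \<pi> i $ k + e k)"
    by (simp add: matrix_mult_monomial[OF \<rho>] monomial_mult_matrix trop_mat_def)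
  finally show ?thesis .
qed

lemma column_equivalent_iff_entries:
  "column_equivalent A B \<longleftrightarrow> (\<exists>\<rho> e. bij \<rho> \<and> (\<forall>i k. B $ i $ \<rho> k = A $ i $ k + e k))"
proof -
  have *: "trop_mat B = trop_mat A ** (\<chi> k j. if j = \<rho> k then Trop (e k) else 0) \<longleftrightarrow>
     (\<forall>i k. B $ i $ \<rho> k = A $ i $ k + e k)" if "bij \<rho>" for \<rho> e
  proof -
    have "(\<chi> i j. if j = id i then Trop 0 else (0::trop)) = (mat 1 :: trop^3^3)"
      by (auto simp: mat_def one_trop_def vec_eq_iff)
    then show ?thesis
      using equivalent_iff_entries[OF that, of B id "\<lambda>_. 0" A e] by simp
  qed
  show ?thesis
  proof
    assume "column_equivalent A B"
    then obtain Q where Q: "permutation_matrix Q" "trop_mat B = trop_mat A ** Q"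
      unfolding column_equivalent_def by (elim exE conjE)
    then obtain e \<rho> where \<rho>: "bij \<rho>" and "Q = (\<chi> k j. if j = \<rho> k then Trop (e k) else 0)"
      unfolding permutation_matrix_alt by (elim exE conjE)
    then have "\<forall>i k. B $ i $ \<rho> k = A $ i $ k + e k"
      using iffD1[OF *[OF \<rho>], of e] Q(2) by simp
    with \<rho> show "\<exists>\<rho> e. bij \<rho> \<and> (\<forall>i k. B $ i $ \<rho> k = A $ i $ k + e k)"
      by (intro exI[of _ \<rho>] exI[of _ e] conjI)
  next
    assume "\<exists>\<rho> e. bij \<rho> \<and> (\<forall>i k. B $ i $ \<rho> k = A $ i $ k + e k)"
    then obtain \<rho> e where \<rho>: "bij \<rho>" and e: "\<forall>i k. B $ i $ \<rho> k = A $ i $ k + e k"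
      by (elim exE conjE)
    define Q :: "trop^3^3" where "Q = (\<chi> k j. if j = \<rho> k then Trop (e k) else 0)"
    have "trop_mat B = trop_mat A ** Q"
      unfolding Q_def by (rule iffD2[OF *[OF \<rho>] e])
    moreover have "permutation_matrix Q" unfolding Q_def
      unfolding permutation_matrix_alt by (intro exI[of _ e] exI[of _ \<rho>] conjI \<rho> refl)
    ultimately show "column_equivalent A B"
      unfolding column_equivalent_def by (intro exI[of _ Q] conjI)
  qed
qed

section \<open>Optimal dual solutions and normal matrices\<close>

text \<open>
  For \<open>p = 0\<close> the duality conditions say that \<open>q k\<close> is the maximum of column \<open>k\<close> and that the
  maxima can be picked in pairwise different rows. Subtracting \<open>q\<close> from the columns and moving
  the chosen entries to the diagonal is precisely a normalization that leaves the rows alone.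
\<close>
lemma column_equivalent_normal_iff:
  "(\<exists>B. column_equivalent A B \<and> normal B) \<longleftrightarrow> dual_optimal A 0"
proof
  assume "\<exists>B. column_equivalent A B \<and> normal B"
  then obtain B \<rho> e where B: "normal B" and \<rho>: "bij \<rho>"
    and "\<forall>i k. B $ i $ \<rho> k = A $ i $ k + e k"
    unfolding column_equivalent_iff_entries by (elim exE conjE)
  note e = this(3)[rule_format]
  show "dual_optimal A 0"
    unfolding dual_optimal_def
  proof (intro exI[of _ "inv \<rho>"] exI[of _ "\<lambda>k. - e k"] conjI allI)
    show "bij (inv \<rho>)" by (rule bij_imp_bij_inv[OF \<rho>])
    show "A $ i $ k \<le> 0 $ i + - e k" for i k
    proof -
      have "B $ i $ \<rho> k \<le> 0" using B unfolding normal_def by blast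
      then have "A $ i $ k + e k \<le> 0" unfolding e .
      then show ?thesis unfolding zero_index by linarith
    qed
    have "\<rho> (inv \<rho> i) = i" for i using \<rho> by (simp add: bij_is_surj surj_f_inv_f)
    moreover have "B $ i $ i = 0" for i using B unfolding normal_def by blast
    ultimately show "A $ i $ inv \<rho> i = 0 $ i + - e (inv \<rho> i)" for i
      using e[of i "inv \<rho> i"] unfolding zero_index by simp
  qed
next
  assume "dual_optimal A 0"
  then obtain \<sigma> q where \<sigma>: "bij \<sigma>" and "\<forall>i k. A $ i $ k \<le> 0 $ i + q k"
    and "\<forall>i. A $ i $ \<sigma> i = 0 $ i + q (\<sigma> i)"
    unfolding dual_optimal_def by (elim exE conjE)
  then have le: "A $ i $ k \<le> q k" and eq: "A $ i $ \<sigma> i = q (\<sigma> i)" for i k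
    by simp_all
  define B :: "real^3^3" where "B = (\<chi> i j. A $ i $ \<sigma> j - q (\<sigma> j))"
  have inv: "\<sigma> (inv \<sigma> k) = k" for k using \<sigma> by (simp add: bij_is_surj surj_f_inv_f)
  have "column_equivalent A B"
    unfolding column_equivalent_iff_entries
  proof (intro exI[of _ "inv \<sigma>"] exI[of _ "\<lambda>k. - q k"] conjI allI)
    show "bij (inv \<sigma>)" by (rule bij_imp_bij_inv[OF \<sigma>])
    show "B $ i $ inv \<sigma> k = A $ i $ k + - q k" for i k by (simp add: B_def inv)
  qed
  moreover have "normal B" by (simp add: normal_def B_def le eq)
  ultimately show "\<exists>B. column_equivalent A B \<and> normal B" by blast
qed

text \<open>
  This is complementary slackness. The identity is a maximal assignment of a normal matrix and
  has weight \<open>0\<close>, so an optimal dual solution has total weight \<open>0\<close>; as every \<open>p $ i + q i\<close> bounds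
  a diagonal entry, all of them vanish, and \<open>q = - p\<close> can be eliminated from the
  inequalities.
\<close>
lemma dual_optimal_normal_iff:
  assumes "normal N"
  shows "dual_optimal N p \<longleftrightarrow> (\<forall>i j. N $ i $ j \<le> p $ i - p $ j)"
proof
  assume "dual_optimal N p"
  then obtain \<sigma> q where \<sigma>: "bij \<sigma>" and "\<forall>i k. N $ i $ k \<le> p $ i + q k"
    and "\<forall>i. N $ i $ \<sigma> i = p $ i + q (\<sigma> i)"
    unfolding dual_optimal_def by (elim exE conjE)
  note le = this(2)[rule_format] and eq = this(3)[rule_format]
  have nonneg: "0 \<le> p $ i + q i" for i using le[of i i] assms by (simp add: normal_def)
  have "(\<Sum>i\<in>UNIV. p $ i + q i) = (\<Sum>i\<in>UNIV. p $ i) + (\<Sum>i\<in>UNIV. q (\<sigma> i))"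
    using sum.reindex_bij_betw[OF \<sigma>, of q] by (simp add: sum.distrib)
  also have "\<dots> = (\<Sum>i\<in>UNIV. N $ i $ \<sigma> i)" by (simp add: eq sum.distrib)
  also have "\<dots> \<le> 0" using assms by (intro sum_nonpos) (simp add: normal_def)
  finally have "(\<Sum>i\<in>UNIV. p $ i + q i) = 0"
    using nonneg by (simp add: antisym sum_nonneg)
  then have "p $ i + q i = 0" for i
    using nonneg by (simp add: sum_nonneg_eq_0_iff)
  then have "q i = - p $ i" for i by (simp add: eq_neg_iff_add_eq_0 add.commute)
  then show "\<forall>i j. N $ i $ j \<le> p $ i - p $ j" using le by simp
next
  assume "\<forall>i j. N $ i $ j \<le> p $ i - p $ j"
  then show "dual_optimal N p"
    unfolding dual_optimal_def using assms
    by (intro exI[of _ id] exI[of _ "\<lambda>k. - p $ k"]) (simp add: normal_def)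
qed

text \<open>
  Permuting the rows and columns of a matrix and adding constants to them transports optimal dual
  solutions by an affine bijection. This is why the description of the soma by dual solutions
  descends from a normalization to the matrix itself.
\<close>
lemma dual_optimal_equivalent_iff:
  assumes \<pi>: "bij \<pi>" and \<rho>: "bij \<rho>"
    and N: "\<And>i k. N $ i $ \<rho> k = c i + A $ \<pi> i $ k + e k"
    and x: "\<And>i. x $ i = c i + y $ \<pi> i"
  shows "dual_optimal N x \<longleftrightarrow> dual_optimal A y"
proof
  assume "dual_optimal N x"
  then obtain \<sigma> q where \<sigma>: "bij \<sigma>" and "\<forall>i k. N $ i $ k \<le> x $ i + q k"
    and "\<forall>i. N $ i $ \<sigma> i = x $ i + q (\<sigma> i)"
    unfolding dual_optimal_def by (elim exE conjE)
  note le = this(2)[rule_format] and eq = this(3)[rule_format]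
  have i: "\<pi> (inv \<pi> i) = i" for i using \<pi> by (simp add: bij_is_surj surj_f_inv_f)
  have k: "\<rho> (inv \<rho> j) = j" for j using \<rho> by (simp add: bij_is_surj surj_f_inv_f)
  show "dual_optimal A y"
    unfolding dual_optimal_def
  proof (intro exI[of _ "inv \<rho> \<circ> \<sigma> \<circ> inv \<pi>"] exI[of _ "\<lambda>k. q (\<rho> k) - e k"] conjI allI)
    show "bij (inv \<rho> \<circ> \<sigma> \<circ> inv \<pi>)" using \<pi> \<rho> \<sigma> by (simp add: bij_comp bij_imp_bij_inv)
    show "A $ i $ k \<le> y $ i + (q (\<rho> k) - e k)" for i k
      using N[of "inv \<pi> i" k] le[of "inv \<pi> i" "\<rho> k"] x[of "inv \<pi> i"] by (simp add: i)
    show "A $ i $ (inv \<rho> \<circ> \<sigma> \<circ> inv \<pi>) i = y $ i +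
        (q (\<rho> ((inv \<rho> \<circ> \<sigma> \<circ> inv \<pi>) i)) - e ((inv \<rho> \<circ> \<sigma> \<circ> inv \<pi>) i))" for i
      using N[of "inv \<pi> i" "inv \<rho> (\<sigma> (inv \<pi> i))"] eq[of "inv \<pi> i"] x[of "inv \<pi> i"]
      by (simp add: i k)
  qed
next
  assume "dual_optimal A y"
  then obtain \<sigma> q where \<sigma>: "bij \<sigma>" and "\<forall>i k. A $ i $ k \<le> y $ i + q k"
    and "\<forall>i. A $ i $ \<sigma> i = y $ i + q (\<sigma> i)"
    unfolding dual_optimal_def by (elim exE conjE)
  note le = this(2)[rule_format] and eq = this(3)[rule_format]
  have k: "\<rho> (inv \<rho> j) = j" for j using \<rho> by (simp add: bij_is_surj surj_f_inv_f)
  have k': "inv \<rho> (\<rho> j) = j" for j using \<rho> by (simp add: bij_is_inj)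
  show "dual_optimal N x"
    unfolding dual_optimal_def
  proof (intro exI[of _ "\<rho> \<circ> \<sigma> \<circ> \<pi>"] exI[of _ "\<lambda>k. q (inv \<rho> k) + e (inv \<rho> k)"] conjI allI)
    show "bij (\<rho> \<circ> \<sigma> \<circ> \<pi>)" using \<pi> \<rho> \<sigma> by (simp add: bij_comp)
    show "N $ i $ k \<le> x $ i + (q (inv \<rho> k) + e (inv \<rho> k))" for i k
      using N[of i "inv \<rho> k"] le[of "\<pi> i" "inv \<rho> k"] by (simp add: k x)
    show "N $ i $ (\<rho> \<circ> \<sigma> \<circ> \<pi>) i = x $ i +
        (q (inv \<rho> ((\<rho> \<circ> \<sigma> \<circ> \<pi>) i)) + e (inv \<rho> ((\<rho> \<circ> \<sigma> \<circ> \<pi>) i)))" for i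
      by (simp add: k' x N eq)
  qed
qed

section \<open>Tropical spans of Kleene stars\<close>

lemma sum_trop_eq_MInf_iff:
  fixes f :: "'a \<Rightarrow> trop"
  assumes "finite S"
  shows "(\<Sum>j\<in>S. f j) = MInf \<longleftrightarrow> (\<forall>j\<in>S. f j = MInf)"
  using assms
proof (induction S)
  case (insert a S)
  have "u + v = MInf \<longleftrightarrow> u = MInf \<and> v = MInf" for u v :: trop by (cases u; cases v) auto
  with insert show ?case by simp
qed (simp add: zero_trop_def)

text \<open>A finite real tropical sum is a maximum: it is attained, and it is an upper bound.\<close>

lemma sum_trop_eq_Trop_iff:
  fixes f :: "'a \<Rightarrow> trop"
  assumes "finite S"
  shows "(\<Sum>j\<in>S. f j) = Trop r \<longleftrightarrow>
    (\<exists>j\<in>S. f j = Trop r) \<and> (\<forall>j\<in>S. \<forall>t. f j = Trop t \<longrightarrow> t \<le> r)"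
  using assms
proof (induction S arbitrary: r)
  case (insert a S)
  show ?case
  proof (cases "f a")
    case MInf
    then show ?thesis using insert by simp
  next
    case (Trop t)
    show ?thesis
    proof (cases "\<Sum>j\<in>S. f j")
      case MInf
      then have "\<forall>j\<in>S. f j = MInf" using insert.hyps sum_trop_eq_MInf_iff by blast
      then show ?thesis using insert.hyps MInf Trop by auto
    next
      case s: (Trop s)
      then have "(\<exists>j\<in>S. f j = Trop s)" "\<forall>j\<in>S. \<forall>t. f j = Trop t \<longrightarrow> t \<le> s"
        using insert.IH by blast+
      then show ?thesis using insert.hyps s Trop
        by (fastforce simp: max_def)
    qed
  qed
qed (simp add: zero_trop_def)

text \<open>
  The assumptions say that \<open>L\<close> is its own Kleene star. The triangle inequality gives
  \<open>L $ i $ j + x $ j \<le> x $ i\<close> for every column \<open>x\<close> of \<open>L\<close>, and tropical combinations preserve this.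
  Conversely, a vector satisfying all these inequalities is the combination of the columns with
  its own coordinates as coefficients: coordinate \<open>i\<close> of that combination is the maximum over
  \<open>j\<close> of \<open>x $ j + L $ i $ j\<close>, which the diagonal entry attains at \<open>j = i\<close>.
\<close>
lemma trop_span_eq_polytrope:
  assumes diag: "\<And>i. L $ i $ i = 0"
    and closed: "\<And>i j k. L $ i $ j + L $ j $ k \<le> L $ i $ k"
  shows "trop_span L = {tpt (trop_vec x) | x. \<forall>i j. L $ i $ j \<le> x $ i - x $ j}"
proof (intro equalityI subsetI)
  fix P assume "P \<in> trop_span L"
  then obtain l where l: "l \<noteq> 0" and P: "P = tpt (\<Sum>j\<in>UNIV. l $ j *s column j (trop_mat L))"
    (is "_ = tpt ?v") unfolding trop_span_def by blast
  have v: "?v $ i = (\<Sum>j\<in>UNIV. l $ j * Trop (L $ i $ j))" for i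
    by (simp add: column_def trop_mat_def)
  obtain m t where "l $ m = Trop t"
    using l by (auto simp: vec_eq_iff zero_trop_def) (metis trop.exhaust)
  then have "?v $ i \<noteq> MInf" for i
    unfolding v by (subst sum_trop_eq_MInf_iff) (auto intro!: exI[of _ m])
  then have "\<forall>i. \<exists>r. ?v $ i = Trop r" using trop.exhaust by metis
  then obtain y where y: "\<And>i. ?v $ i = Trop (y i)" by metis
  define x :: "real^3" where "x = (\<chi> i. y i)"
  have x: "?v = trop_vec x" using y by (simp add: trop_vec_def x_def vec_eq_iff)
  have "L $ i $ j \<le> x $ i - x $ j" for i j
  proof -
    have "(\<Sum>k\<in>UNIV. l $ k * Trop (L $ j $ k)) = Trop (x $ j)"
      using y[of j] unfolding v x_def by simp
    then obtain k where k: "l $ k * Trop (L $ j $ k) = Trop (x $ j)"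
      by (subst (asm) sum_trop_eq_Trop_iff) auto
    then obtain t where t: "l $ k = Trop t" by (cases "l $ k") auto
    have "(\<Sum>k\<in>UNIV. l $ k * Trop (L $ i $ k)) = Trop (x $ i)"
      using y[of i] unfolding v x_def by simp
    then have "t + L $ i $ k \<le> x $ i"
      using t by (subst (asm) sum_trop_eq_Trop_iff) (auto dest!: spec[of _ k])
    with k t closed[of i j k] show ?thesis by simp
  qed
  with P x show "P \<in> {tpt (trop_vec x) | x. \<forall>i j. L $ i $ j \<le> x $ i - x $ j}"
    by auto
next
  fix P assume "P \<in> {tpt (trop_vec x) | x. \<forall>i j. L $ i $ j \<le> x $ i - x $ j}"
  then obtain x where P: "P = tpt (trop_vec x)" and le: "\<And>i j. L $ i $ j \<le> x $ i - x $ j"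
    by blast
  have "(\<Sum>j\<in>UNIV. Trop (x $ j) * Trop (L $ i $ j)) = Trop (x $ i)" for i
    using le[of i] by (subst sum_trop_eq_Trop_iff) (auto simp: diag algebra_simps intro!: exI[of _ i])
  then have "trop_vec x = (\<Sum>j\<in>UNIV. trop_vec x $ j *s column j (trop_mat L))"
    by (simp add: vec_eq_iff column_def trop_mat_def trop_vec_def)
  then show "P \<in> trop_span L"
    unfolding trop_span_def P using trop_vec_nonzero[of x]
    by (intro CollectI exI[of _ "trop_vec x"]) simp
qed

section \<open>The soma as the set of optimal dual solutions\<close>

lemma normal_F_mat:
  assumes "F_params d d1 d2 d3 h1 h2 h3 g"
  shows "normal (F_mat d d1 d2 d3 h1 h2 h3 g)"
  using assms by (auto simp: normal_def F_params_def F_mat_def forall_3)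

text \<open>
  At each position where a positive \<open>h1\<close>, \<open>h2\<close>, \<open>h3\<close> or \<open>g\<close> makes \<open>F_mat\<close> smaller than \<open>L_mat\<close>,
  the entry of \<open>L_mat\<close> is the weight of a detour through the third index: for instance, the entry \<open>(1, 3)\<close> of \<open>L_mat\<close> is the sum of the entries
  \<open>(1, 2)\<close> and \<open>(2, 3)\<close> if \<open>d2 = 0\<close>, as is the case for \<open>h3 > 0\<close>. Adding the inequalities along the
  detour recovers the stronger bound, provided that the detour itself is not lowered. For this
  reason a positive \<open>g\<close> forces \<open>h3 = 0\<close> (by \<open>F_params\<close>) and \<open>h1 = 0\<close>.
\<close>
lemma F_mat_inequalities_iff_L_mat:
  assumes "F_params d d1 d2 d3 h1 h2 h3 g" "g > 0 \<longrightarrow> h1 = 0"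
  shows "(\<forall>i j. F_mat d d1 d2 d3 h1 h2 h3 g $ i $ j \<le> x $ i - x $ j) \<longleftrightarrow>
    (\<forall>i j. L_mat d d1 d2 d3 $ i $ j \<le> x $ i - x $ j)"
proof
  assume "\<forall>i j. F_mat d d1 d2 d3 h1 h2 h3 g $ i $ j \<le> x $ i - x $ j"
  then have "- d - d2 \<le> x $ 1 - x $ 2" "- 2 * d - d3 - h3 \<le> x $ 1 - x $ 3"
    "- 2 * d - d1 - h1 \<le> x $ 2 - x $ 1" "- d - d3 - g \<le> x $ 2 - x $ 3"
    "- d - d1 \<le> x $ 3 - x $ 1" "- 2 * d - d2 - h2 \<le> x $ 3 - x $ 2"
    unfolding F_mat_def forall_3 vector_3 by blast+
  then have "- d - d2 \<le> x $ 1 - x $ 2" "- 2 * d - d3 \<le> x $ 1 - x $ 3"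
    "- 2 * d - d1 \<le> x $ 2 - x $ 1" "- d - d3 \<le> x $ 2 - x $ 3"
    "- d - d1 \<le> x $ 3 - x $ 1" "- 2 * d - d2 \<le> x $ 3 - x $ 2"
    using assms unfolding F_params_def by linarith+
  then show "\<forall>i j. L_mat d d1 d2 d3 $ i $ j \<le> x $ i - x $ j"
    by (simp add: L_mat_def F_mat_def forall_3)
next
  assume "\<forall>i j. L_mat d d1 d2 d3 $ i $ j \<le> x $ i - x $ j"
  moreover have "\<forall>i j. F_mat d d1 d2 d3 h1 h2 h3 g $ i $ j \<le> L_mat d d1 d2 d3 $ i $ j"
    using assms(1) by (simp add: L_mat_def F_mat_def F_params_def forall_3)
  ultimately show "\<forall>i j. F_mat d d1 d2 d3 h1 h2 h3 g $ i $ j \<le> x $ i - x $ j"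
    using order_trans by blast
qed

lemma trop_span_L_mat:
  assumes "d \<ge> 0" "d1 \<ge> 0" "d2 \<ge> 0" "d3 \<ge> 0"
  shows "trop_span (L_mat d d1 d2 d3) =
    {tpt (trop_vec x) | x. \<forall>i j. L_mat d d1 d2 d3 $ i $ j \<le> x $ i - x $ j}"
proof (rule trop_span_eq_polytrope)
  have "\<forall>i. L_mat d d1 d2 d3 $ i $ i = 0"
    by (simp add: L_mat_def F_mat_def forall_3)
  then show "L_mat d d1 d2 d3 $ i $ i = 0" for i by blast
  have "\<forall>i j k. L_mat d d1 d2 d3 $ i $ j + L_mat d d1 d2 d3 $ j $ k \<le> L_mat d d1 d2 d3 $ i $ k"
    using assms by (simp add: L_mat_def F_mat_def forall_3)
  then show "L_mat d d1 d2 d3 $ i $ j + L_mat d d1 d2 d3 $ j $ k \<le> L_mat d d1 d2 d3 $ i $ k"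
    for i j k by blast
qed

text \<open>
  The right-hand side does not mention the normalization, so this contains the uniqueness of the
  soma. For a normalization \<open>N\<close> of \<open>A\<close>, the points of the span of \<open>L_mat\<close> are those \<open>x\<close> with
  \<open>N $ i $ j \<le> x $ i - x $ j\<close>, hence the optimal dual solutions of \<open>N\<close>; the inverse of \<open>P\<close> carries
  them to those of \<open>A\<close>.
\<close>
lemma is_soma_imp_eq_dual_optimal:
  assumes "is_soma A S"
  shows "S = {tpt (trop_vec p) | p. dual_optimal A p}"
proof -
  obtain P Q d d1 d2 d3 h1 h2 h3 g
    where lcn: "lower_canonical_normalization A P Q d d1 d2 d3 h1 h2 h3 g"
      and S: "S = trop_map (matrix_inv P) ` trop_span (L_mat d d1 d2 d3)"
    using assms unfolding is_soma_def by (elim exE conjE)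
  let ?N = "F_mat d d1 d2 d3 h1 h2 h3 g"
  have par: "F_params d d1 d2 d3 h1 h2 h3 g" "g > 0 \<longrightarrow> h1 = 0"
    and PP: "permutation_matrix P" and QQ: "permutation_matrix Q"
    and eqN: "trop_mat ?N = P ** trop_mat A ** Q"
    using lcn unfolding lower_canonical_normalization_def by blast+
  obtain c \<pi> where \<pi>: "bij \<pi>" and P: "P = (\<chi> i j. if j = \<pi> i then Trop (c i) else 0)"
    using PP unfolding permutation_matrix_alt by (elim exE conjE)
  obtain e \<rho> where \<rho>: "bij \<rho>" and Q: "Q = (\<chi> i j. if j = \<rho> i then Trop (e i) else 0)"
    using QQ unfolding permutation_matrix_alt by (elim exE conjE)
  have N: "?N $ i $ \<rho> k = c i + A $ \<pi> i $ k + e k" for i k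
    using eqN unfolding P Q equivalent_iff_entries[OF \<rho>] by blast
  have span: "trop_span (L_mat d d1 d2 d3) = {tpt (trop_vec x) | x. dual_optimal ?N x}"
  proof -
    have "trop_span (L_mat d d1 d2 d3) =
        {tpt (trop_vec x) | x. \<forall>i j. L_mat d d1 d2 d3 $ i $ j \<le> x $ i - x $ j}"
      using par(1) by (intro trop_span_L_mat) (auto simp: F_params_def)
    then show ?thesis
      by (simp only: dual_optimal_normal_iff[OF normal_F_mat[OF par(1)]]
          F_mat_inequalities_iff_L_mat[OF par])
  qed
  have inv: "matrix_inv P ** P = mat 1"
  proof -
    have "\<exists>R. P ** R = mat 1 \<and> R ** P = mat 1" by (metis permutation_matrix_inverse[OF PP])
    then show ?thesis unfolding matrix_inv_def by (rule someI2_ex) (rule conjunct2)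
  qed
  have move: "trop_map (matrix_inv P) (tpt (trop_vec x)) = tpt (trop_vec y)"
    if "\<And>i. x $ i = c i + y $ \<pi> i" for x y
  proof -
    have "trop_vec x = P *v trop_vec y"
      by (simp add: P vec_eq_iff monomial_mult_vec trop_vec_def that)
    then have "matrix_inv P *v trop_vec x = trop_vec y"
      by (simp add: matrix_vector_mul_assoc inv)
    then show ?thesis using trop_map_tpt[of "trop_vec x" "matrix_inv P"] trop_vec_nonzero by metis
  qed
  show ?thesis
  proof (intro equalityI subsetI)
    fix z assume "z \<in> S"
    then obtain x where x: "dual_optimal ?N x" and z: "z = trop_map (matrix_inv P) (tpt (trop_vec x))"
      unfolding S span by blast
    define y :: "real^3" where "y = (\<chi> k. x $ inv \<pi> k - c (inv \<pi> k))"
    have xy: "x $ i = c i + y $ \<pi> i" for i using \<pi> by (simp add: y_def bij_is_inj)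
    have "dual_optimal A y" using dual_optimal_equivalent_iff[OF \<pi> \<rho> N xy] x by blast
    then show "z \<in> {tpt (trop_vec p) | p. dual_optimal A p}"
      using move[OF xy] z by blast
  next
    fix z assume "z \<in> {tpt (trop_vec p) | p. dual_optimal A p}"
    then obtain y where y: "dual_optimal A y" and z: "z = tpt (trop_vec y)" by blast
    define x :: "real^3" where "x = (\<chi> i. c i + y $ \<pi> i)"
    have xy: "x $ i = c i + y $ \<pi> i" for i by (simp add: x_def)
    have "dual_optimal ?N x" using dual_optimal_equivalent_iff[OF \<pi> \<rho> N xy] y by blast
    then show "z \<in> S"
      unfolding S span using move[OF xy] z by (metis (mono_tags, lifting) image_eqI mem_Collect_eq)
  qed
qed

section \<open>Maximal assignments\<close>

text \<open>
  The existence proof relabels the three indices in several ways. It is written for an arbitrary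
  enumeration \<open>i, j, k\<close> of the index type.
\<close>
lemma univ_3_distinct:
  fixes i j k :: 3
  assumes "i \<noteq> j" "j \<noteq> k" "i \<noteq> k"
  shows "UNIV = {i, j, k}"
proof -
  have "card {i, j, k} = CARD(3)" using assms by simp
  then show ?thesis by (metis card_subset_eq finite_class.finite_UNIV subset_UNIV)
qed

lemma bij_3_distinct:
  fixes i j k i' j' k' :: 3
  assumes "i \<noteq> j" "j \<noteq> k" "i \<noteq> k" "i' \<noteq> j'" "j' \<noteq> k'" "i' \<noteq> k'"
  shows "bij (\<lambda>m. if m = i then i' else if m = j then j' else k')"
proof -
  have "m \<in> {i, j, k}" for m using univ_3_distinct[OF assms(1-3)] by blast
  then have "inj (\<lambda>m. if m = i then i' else if m = j then j' else k')"
    using assms by (intro injI) (auto split: if_splits)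
  then show ?thesis
    unfolding bij_def using finite_UNIV_inj_surj[OF finite_class.finite_UNIV] by (intro conjI)
qed

definition maximal_assignment :: "real^'n^'n \<Rightarrow> ('n \<Rightarrow> 'n) \<Rightarrow> bool" where
  "maximal_assignment A \<tau> \<longleftrightarrow> bij \<tau> \<and>
     (\<forall>\<sigma>. bij \<sigma> \<longrightarrow> (\<Sum>i\<in>UNIV. A $ i $ \<sigma> i) \<le> (\<Sum>i\<in>UNIV. A $ i $ \<tau> i))"

lemma maximal_assignment_exists: "\<exists>\<tau>. maximal_assignment A \<tau>"
proof -
  let ?w = "\<lambda>\<sigma>. \<Sum>i\<in>UNIV. A $ i $ \<sigma> i"
  have "finite (?w ` Collect bij)" "?w ` Collect bij \<noteq> {}" using bij_id by auto
  then have "Max (?w ` Collect bij) \<in> ?w ` Collect bij" by (rule Max_in)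
  then obtain \<tau> where \<tau>: "bij \<tau>" "Max (?w ` Collect bij) = ?w \<tau>" by auto
  have "?w \<sigma> \<le> ?w \<tau>" if "bij \<sigma>" for \<sigma>
    unfolding \<tau>(2)[symmetric] using that by (intro Max_ge) auto
  with \<tau>(1) show ?thesis unfolding maximal_assignment_def by (intro exI[of _ \<tau>]) simp
qed

text \<open>
  Entry \<open>(i, j)\<close> after \<open>\<tau>\<close> has been moved to the diagonal and each column rescaled to have \<open>0\<close> there.
\<close>
definition rescaled_entry :: "real^'n^'n \<Rightarrow> ('n \<Rightarrow> 'n) \<Rightarrow> 'n \<Rightarrow> 'n \<Rightarrow> real" where
  "rescaled_entry A \<tau> i j = A $ i $ \<tau> j - A $ j $ \<tau> j"

text \<open>
  The weight of a cycle is the change in total weight when the cycle is composed with the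
  assignment \<open>\<tau>\<close>, hence is not positive by maximality.
\<close>
lemma rescaled_entry_cycles:
  fixes A :: "real^3^3"
  assumes "maximal_assignment A \<tau>" and dist: "i \<noteq> j" "j \<noteq> k" "i \<noteq> k"
  shows "rescaled_entry A \<tau> i j + rescaled_entry A \<tau> j i \<le> 0"
    and "rescaled_entry A \<tau> i j + rescaled_entry A \<tau> j k + rescaled_entry A \<tau> k i \<le> 0"
proof -
  have \<tau>: "bij \<tau>" using assms unfolding maximal_assignment_def by blast
  have sum: "(\<Sum>m\<in>UNIV. f m) = f i + f j + f k" for f :: "3 \<Rightarrow> real"
    using dist by (simp add: univ_3_distinct[OF dist])
  have le: "A $ i $ \<tau> i' + A $ j $ \<tau> j' + A $ k $ \<tau> k' \<le> A $ i $ \<tau> i + A $ j $ \<tau> j + A $ k $ \<tau> k"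
    if "i' \<noteq> j'" "j' \<noteq> k'" "i' \<noteq> k'" for i' j' k'
  proof -
    let ?\<sigma> = "\<tau> \<circ> (\<lambda>m. if m = i then i' else if m = j then j' else k')"
    have "bij ?\<sigma>" using bij_comp[OF bij_3_distinct[OF dist that] \<tau>] .
    then have "(\<Sum>m\<in>UNIV. A $ m $ ?\<sigma> m) \<le> (\<Sum>m\<in>UNIV. A $ m $ \<tau> m)"
      by (rule assms(1)[unfolded maximal_assignment_def, THEN conjunct2, rule_format])
    then show ?thesis unfolding sum using dist by simp
  qed
  show "rescaled_entry A \<tau> i j + rescaled_entry A \<tau> j i \<le> 0"
    using le[of j i k] dist by (simp add: rescaled_entry_def)
  show "rescaled_entry A \<tau> i j + rescaled_entry A \<tau> j k + rescaled_entry A \<tau> k i \<le> 0"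
    using le[of j k i] dist by (simp add: rescaled_entry_def)
qed

section \<open>Existence of a lower canonical normalization\<close>

text \<open>
  Here \<open>i, j, k\<close> play the roles of the indices \<open>1, 2, 3\<close> of \<open>F_mat\<close>, and \<open>x, y, z\<close> are
  subtracted from the corresponding rows and added to the columns.
\<close>
lemma lower_canonical_normalizationI:
  fixes i j k :: 3
  assumes \<tau>: "bij \<tau>" and dist: "i \<noteq> j" "j \<noteq> k" "i \<noteq> k"
    and par: "F_params d d1 d2 d3 h1 h2 h3 g" "g > 0 \<longrightarrow> h1 = 0"
    and entries:
      "rescaled_entry A \<tau> i j = x - y - d - d2"
      "rescaled_entry A \<tau> i k = x - z - 2 * d - d3 - h3"
      "rescaled_entry A \<tau> j i = y - x - 2 * d - d1 - h1"
      "rescaled_entry A \<tau> j k = y - z - d - d3 - g"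
      "rescaled_entry A \<tau> k i = z - x - d - d1"
      "rescaled_entry A \<tau> k j = z - y - 2 * d - d2 - h2"
  shows "\<exists>P Q. lower_canonical_normalization A P Q d d1 d2 d3 h1 h2 h3 g"
proof -
  define \<pi> :: "3 \<Rightarrow> 3" where "\<pi> = (\<lambda>m. if m = 1 then i else if m = 2 then j else k)"
  define p :: "3 \<Rightarrow> real" where "p = (\<lambda>m. if m = 1 then x else if m = 2 then y else z)"
  have \<pi>: "bij \<pi>" unfolding \<pi>_def using dist by (intro bij_3_distinct[of 1 2 3]) auto
  have vals: "\<pi> 1 = i" "\<pi> 2 = j" "\<pi> 3 = k" "p 1 = x" "p 2 = y" "p 3 = z"
    by (simp_all add: \<pi>_def p_def)
  let ?N = "F_mat d d1 d2 d3 h1 h2 h3 g"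
  have N: "\<forall>m n. ?N $ m $ n = rescaled_entry A \<tau> (\<pi> m) (\<pi> n) - p m + p n"
    by (simp add: forall_3 vals F_mat_def entries) (simp add: rescaled_entry_def)
  define \<rho> where "\<rho> = inv (\<tau> \<circ> \<pi>)"
  have \<tau>\<pi>: "bij (\<tau> \<circ> \<pi>)" by (rule bij_comp[OF \<pi> \<tau>])
  have \<rho>: "bij \<rho>" unfolding \<rho>_def by (rule bij_imp_bij_inv[OF \<tau>\<pi>])
  have inverse_at: "\<tau> (\<pi> (\<rho> n)) = n" for n
    using surj_f_inv_f[OF bij_is_surj[OF \<tau>\<pi>], of n] by (simp add: \<rho>_def)
  define e where "e = (\<lambda>n. p (\<rho> n) - A $ \<pi> (\<rho> n) $ n)"
  define P :: "trop^3^3" where "P = (\<chi> i j. if j = \<pi> i then Trop (- p i) else 0)"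
  define Q :: "trop^3^3" where "Q = (\<chi> k j. if j = \<rho> k then Trop (e k) else 0)"
  have "\<forall>m n. ?N $ m $ \<rho> n = - p m + A $ \<pi> m $ n + e n"
    by (simp add: N rescaled_entry_def inverse_at e_def)
  then have "trop_mat ?N = P ** trop_mat A ** Q"
    unfolding P_def Q_def by (rule iffD2[OF equivalent_iff_entries[OF \<rho>]])
  moreover have "permutation_matrix P"
    unfolding permutation_matrix_alt P_def
    by (intro exI[of _ "\<lambda>i. - p i"] exI[of _ \<pi>] conjI \<pi> refl)
  moreover have "permutation_matrix Q"
    unfolding permutation_matrix_alt Q_def by (intro exI[of _ e] exI[of _ \<rho>] conjI \<rho> refl)
  ultimately show ?thesis
    unfolding lower_canonical_normalization_def using par
    by (intro exI[of _ P] exI[of _ Q] conjI)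
qed

text \<open>
  The assumptions \<open>tri\<close> say that the \<open>k\<close>'s are the off-diagonal entries of a Kleene star. Up to
  translation such a star is determined by the weights of its cycles, three of length two and two
  of length three, with one linear relation: both groups have the same sum. That leaves the four
  parameters of \<open>L_mat\<close>, and they are found by comparing cycles: the cycle \<open>1, 2, 3\<close> in \<open>L_mat\<close> exceeds
  the reversed one by \<open>3 * d\<close>, and each \<open>d1\<close>, \<open>d2\<close>, \<open>d3\<close> is the defect of one triangle inequality.
\<close>
lemma parameters_of_closure:
  fixes k12 k13 k21 k23 k31 k32 :: real
  assumes tri: "k13 + k32 \<le> k12" "k12 + k23 \<le> k13" "k23 + k31 \<le> k21"
      "k21 + k13 \<le> k23" "k32 + k21 \<le> k31" "k31 + k12 \<le> k32"
    and orient: "k13 + k32 + k21 \<le> k12 + k23 + k31"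
  obtains d d1 d2 d3 x y z where
    "0 \<le> d" "0 \<le> d1" "0 \<le> d2" "0 \<le> d3"
    "k12 = x - y - d - d2" "k13 = x - z - 2 * d - d3" "k21 = y - x - 2 * d - d1"
    "k23 = y - z - d - d3" "k31 = z - x - d - d1" "k32 = z - y - 2 * d - d2"
proof -
  define d where "d = (k12 + k23 + k31 - (k13 + k32 + k21)) / 3"
  define d1 where "d1 = k32 - k31 - k12"
  define d2 where "d2 = k13 - k12 - k23"
  define d3 where "d3 = k21 - k23 - k31"
  define y where "y = k23 + d + d3"
  define x where "x = y + k12 + d + d2"
  note defs = d_def d1_def d2_def d3_def x_def y_def
  show thesis
  proof (rule that[of d d1 d2 d3 x y 0])
    show "0 \<le> d" "0 \<le> d1" "0 \<le> d2" "0 \<le> d3" using tri orient by (simp_all add: defs)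
    show "k12 = x - y - d - d2" "k23 = y - 0 - d - d3" by (simp_all add: x_def y_def)
    show "k13 = x - 0 - 2 * d - d3" "k21 = y - x - 2 * d - d1"
      "k31 = 0 - x - d - d1" "k32 = 0 - y - 2 * d - d2"
      by (simp_all add: defs field_simps)
  qed
qed

text \<open>
  Closing the six off-diagonal entries \<open>b\<close> under detours yields a Kleene star, which is a translate
  of some \<open>L_mat\<close>. The slack between the star and \<open>b\<close> has to be distributed over \<open>h1, h2, h3, g\<close>,
  which sit at the positions \<open>(2, 1)\<close>, \<open>(3, 2)\<close>, \<open>(1, 3)\<close>, \<open>(2, 3)\<close>. A pair with positive slack is
  reached by a detour, and neither leg of the detour has slack. Hence if both orientations of the
  3-cycle contain a pair with slack, then for a pair with slack the reversed pair is the only other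
  one with slack, and the third vertex is a centre without slack on its four arcs. So either some
  orientation of the 3-cycle is free of slack, and the rest becomes \<open>h1, h2, h3\<close>, or a centre exists,
  which is made index \<open>1\<close>, and the rest becomes \<open>h2\<close> and \<open>g\<close>. Relabelling is
  harmless: the positions \<open>(1, 2)\<close>, \<open>(2, 3)\<close>, \<open>(3, 1)\<close> can carry slack only for \<open>d = 0\<close>, and then
  permuting the indices together with \<open>d1, d2, d3\<close> preserves the shape of \<open>L_mat\<close>.
\<close>
lemma lower_canonical_normalization_oriented:
  fixes A :: "real^3^3" and \<tau> :: "3 \<Rightarrow> 3" and i j k :: 3
  defines "b \<equiv> rescaled_entry A \<tau>"
  assumes max: "maximal_assignment A \<tau>" and dist: "i \<noteq> j" "j \<noteq> k" "i \<noteq> k"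
    and orient: "max (b i k) (b i j + b j k) + max (b k j) (b k i + b i j) + max (b j i) (b j k + b k i)
      \<le> max (b i j) (b i k + b k j) + max (b j k) (b j i + b i k) + max (b k i) (b k j + b j i)"
  shows "\<exists>P Q d d1 d2 d3 h1 h2 h3 g. lower_canonical_normalization A P Q d d1 d2 d3 h1 h2 h3 g"
proof -
  have \<tau>: "bij \<tau>" using max unfolding maximal_assignment_def by blast
  have "b i j + b j i \<le> 0" "b i k + b k i \<le> 0" "b j k + b k j \<le> 0"
      "b i j + b j k + b k i \<le> 0" "b i k + b k j + b j i \<le> 0"
    unfolding b_def
    using rescaled_entry_cycles[OF max dist] rescaled_entry_cycles[OF max, of i k j]
      rescaled_entry_cycles[OF max, of j k i] dist by auto
  note cyc = this
  define k12 k13 k21 k23 k31 k32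
    where k_defs: "k12 = max (b i j) (b i k + b k j)" "k13 = max (b i k) (b i j + b j k)"
      "k21 = max (b j i) (b j k + b k i)" "k23 = max (b j k) (b j i + b i k)"
      "k31 = max (b k i) (b k j + b j i)" "k32 = max (b k j) (b k i + b i j)"
  have tri: "k13 + k32 \<le> k12" "k12 + k23 \<le> k13" "k23 + k31 \<le> k21"
      "k21 + k13 \<le> k23" "k32 + k21 \<le> k31" "k31 + k12 \<le> k32"
    using cyc unfolding k_defs by (simp_all add: max_def split: if_splits)
  define s12 s13 s21 s23 s31 s32
    where s_defs: "s12 = k12 - b i j" "s13 = k13 - b i k" "s21 = k21 - b j i"
      "s23 = k23 - b j k" "s31 = k31 - b k i" "s32 = k32 - b k j"
  have nonneg: "0 \<le> s12" "0 \<le> s13" "0 \<le> s21" "0 \<le> s23" "0 \<le> s31" "0 \<le> s32"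
    by (simp_all add: s_defs k_defs)
  \<comment> \<open>Every pair either has no slack or is reached by a detour of the same weight in \<open>b\<close>.\<close>
  have path: "s12 = 0 \<or> k12 = (k13 - s13) + (k32 - s32)" "s13 = 0 \<or> k13 = (k12 - s12) + (k23 - s23)"
      "s21 = 0 \<or> k21 = (k23 - s23) + (k31 - s31)" "s23 = 0 \<or> k23 = (k21 - s21) + (k13 - s13)"
      "s31 = 0 \<or> k31 = (k32 - s32) + (k21 - s21)" "s32 = 0 \<or> k32 = (k31 - s31) + (k12 - s12)"
    unfolding s_defs by (simp_all, simp_all add: k_defs max_def)
  obtain d d1 d2 d3 x y z where par: "0 \<le> d" "0 \<le> d1" "0 \<le> d2" "0 \<le> d3"
    and ks: "k12 = x - y - d - d2" "k13 = x - z - 2 * d - d3" "k21 = y - x - 2 * d - d1"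
      "k23 = y - z - d - d3" "k31 = z - x - d - d1" "k32 = z - y - 2 * d - d2"
    by (rule parameters_of_closure[OF tri orient[folded k_defs]])
  \<comment> \<open>The detour also bounds the entry from below in the star, so its legs have no slack, and
    comparing the entries of \<open>L_mat\<close> gives the equations between the parameters.\<close>
  have slack12: "s12 = 0 \<or> d = 0 \<and> d3 = 0 \<and> s13 = 0 \<and> s32 = 0"
    using path(1) nonneg par unfolding ks by linarith
  have slack13: "s13 = 0 \<or> d2 = 0 \<and> s12 = 0 \<and> s23 = 0"
    using path(2) nonneg par unfolding ks by linarith
  have slack21: "s21 = 0 \<or> d3 = 0 \<and> s23 = 0 \<and> s31 = 0"
    using path(3) nonneg par unfolding ks by linarith
  have slack23: "s23 = 0 \<or> d = 0 \<and> d1 = 0 \<and> s21 = 0 \<and> s13 = 0"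
    using path(4) nonneg par unfolding ks by linarith
  have slack31: "s31 = 0 \<or> d = 0 \<and> d2 = 0 \<and> s32 = 0 \<and> s21 = 0"
    using path(5) nonneg par unfolding ks by linarith
  have slack32: "s32 = 0 \<or> d1 = 0 \<and> s31 = 0 \<and> s12 = 0"
    using path(6) nonneg par unfolding ks by linarith
  have b: "b i j = x - y - d - d2 - s12" "b i k = x - z - 2 * d - d3 - s13"
      "b j i = y - x - 2 * d - d1 - s21" "b j k = y - z - d - d3 - s23"
      "b k i = z - x - d - d1 - s31" "b k j = z - y - 2 * d - d2 - s32"
    by (simp_all add: s_defs flip: ks)
  note b = b[unfolded b_def]
  have witness: ?thesis
    if "\<exists>P Q. lower_canonical_normalization A P Q d d1 d2 d3 h1 h2 h3 g" for d d1 d2 d3 h1 h2 h3 g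
    using that by blast
  \<comment> \<open>The first two cases are the orientations of the 3-cycle, the others have the centres
    \<open>i\<close>, \<open>j\<close> and \<open>k\<close>.\<close>
  consider "s12 = 0" "s23 = 0" "s31 = 0"
    | "d = 0" "s13 = 0" "s32 = 0" "s21 = 0"
    | "d = 0" "d1 = 0" "s12 = 0" "s21 = 0" "s13 = 0" "s31 = 0"
    | "d = 0" "d2 = 0" "s12 = 0" "s21 = 0" "s23 = 0" "s32 = 0"
    | "d = 0" "d3 = 0" "s13 = 0" "s31 = 0" "s23 = 0" "s32 = 0"
    using slack12 slack13 slack21 slack23 slack31 slack32 by argo
  then show ?thesis
  proof cases
    case 1
    have "\<exists>P Q. lower_canonical_normalization A P Q d d1 d2 d3 s21 s32 s13 0"
      using slack13 slack21 slack32 par nonneg 1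
      by (intro lower_canonical_normalizationI[OF \<tau> dist, where x = x and y = y and z = z])
        (auto simp: F_params_def b)
    then show ?thesis by (rule witness)
  next
    case 2
    have "\<exists>P Q. lower_canonical_normalization A P Q 0 d1 d3 d2 s31 s23 s12 0"
      using slack12 slack23 slack31 par nonneg 2 dist
      by (intro lower_canonical_normalizationI[OF \<tau>, of i k j, where x = x and y = z and z = y])
        (auto simp: F_params_def b)
    then show ?thesis by (rule witness)
  next
    case 3
    have "\<exists>P Q. lower_canonical_normalization A P Q 0 0 d2 d3 0 s32 0 s23"
      using par nonneg 3 dist
      by (intro lower_canonical_normalizationI[OF \<tau>, of i j k, where x = x and y = y and z = z])
        (auto simp: F_params_def b)
    then show ?thesis by (rule witness)
  next
    case 4
    have "\<exists>P Q. lower_canonical_normalization A P Q 0 0 d3 d1 0 s13 0 s31"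
      using par nonneg 4 dist
      by (intro lower_canonical_normalizationI[OF \<tau>, of j k i, where x = y and y = z and z = x])
        (auto simp: F_params_def b)
    then show ?thesis by (rule witness)
  next
    case 5
    have "\<exists>P Q. lower_canonical_normalization A P Q 0 0 d1 d2 0 s21 0 s12"
      using par nonneg 5 dist
      by (intro lower_canonical_normalizationI[OF \<tau>, of k i j, where x = z and y = x and z = y])
        (auto simp: F_params_def b)
    then show ?thesis by (rule witness)
  qed
qed

text \<open>
  Exchanging two indices reverses the orientation of the 3-cycle, so one of the two labellings
  satisfies the comparison of cycles required above.
\<close>
lemma lower_canonical_normalization_exists:
  fixes A :: "real^3^3"
  shows "\<exists>P Q d d1 d2 d3 h1 h2 h3 g. lower_canonical_normalization A P Q d d1 d2 d3 h1 h2 h3 g"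
proof -
  obtain \<tau> where \<tau>: "maximal_assignment A \<tau>" using maximal_assignment_exists by blast
  have dist: "(1::3) \<noteq> 2" "(2::3) \<noteq> 3" "(1::3) \<noteq> 3" by simp_all
  show ?thesis
    using lower_canonical_normalization_oriented[OF \<tau> dist]
      lower_canonical_normalization_oriented[OF \<tau> dist(3) dist(2)[symmetric] dist(1)]
    by (rule linorder_le_cases) (simp_all only: ac_simps)
qed

section \<open>Normality and the origin\<close>

lemma soma_eq_dual_optimal: "soma A = {tpt (trop_vec p) | p. dual_optimal A p}"
proof -
  have "\<exists>S. is_soma A S"
    using lower_canonical_normalization_exists[of A] unfolding is_soma_def by blast
  then show ?thesis
    unfolding soma_def using is_soma_imp_eq_dual_optimal by (metis (no_types, lifting) theI)
qed

lemma dual_optimal_shift: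
  assumes "\<And>i. p $ i = q $ i + c" "dual_optimal A p"
  shows "dual_optimal A q"
proof -
  from assms(2) obtain \<sigma> u where "bij \<sigma>" "\<forall>i k. A $ i $ k \<le> p $ i + u k"
    "\<forall>i. A $ i $ \<sigma> i = p $ i + u (\<sigma> i)"
    unfolding dual_optimal_def by (elim exE conjE)
  then show ?thesis
    unfolding dual_optimal_def
    by (intro exI[of _ \<sigma>] exI[of _ "\<lambda>k. c + u k"]) (simp add: assms(1) add.assoc)
qed

theorem theorem2:
  fixes A :: "real^3^3"
  shows "(\<exists>B. column_equivalent A B \<and> normal B) \<longleftrightarrow> origin \<in> soma A"
proof -
  have origin: "origin = tpt (trop_vec 0)"
    unfolding origin_def trop_vec_def
    by (rule arg_cong[where f = tpt]) (simp add: vec_eq_iff forall_3)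
  have "origin \<in> soma A \<longleftrightarrow> dual_optimal A 0"
  proof
    assume "origin \<in> soma A"
    then obtain p where eq: "tpt (trop_vec p) = tpt (trop_vec 0)" and p: "dual_optimal A p"
      unfolding soma_eq_dual_optimal origin by auto
    obtain c where "trop_vec 0 = Trop c *s trop_vec p"
      using eq tpt_eq_iff[OF trop_vec_nonzero trop_vec_nonzero] by blast
    then have "0 = c + p $ i" for i
      by (simp add: vec_eq_iff trop_vec_def)
    then have "p $ i = 0 $ i + - c" for i by (simp add: eq_neg_iff_add_eq_0 add.commute)
    then show "dual_optimal A 0" using p by (rule dual_optimal_shift)
  next
    assume "dual_optimal A 0"
    then show "origin \<in> soma A" unfolding soma_eq_dual_optimal origin by blast
  qed
  then show ?thesis unfolding column_equivalent_normal_iff by simp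
qed

end
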